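(* Let $r$ be a positive real number and let $(a_{\mathbf{n}})_{\mathbf{n}\in\mathbb{N}^d}$ be a nonnegative $d$-sequence. Suppose that $(b_{\mathbf{n}})_{\mathbf{n}\in\mathbb{N}^d}$ is a positive, nondecreasing $d$-sequence of product type. Then the following two statements are equivalent. (i) There exists $C>0$ such that for any $\mathbf{n}\in\mathbb{N}^d$ and any $\varepsilon>0$, $$\mathbb{P}\Big(\max_{\boldsymbol{\ell}\le\mathbf{n}}|S_{\boldsymbol{\ell}}|\ge\varepsilon\Big)\le C\,\varepsilon^{-r}\sum_{\boldsymbol{\ell}\le\mathbf{n}}a_{\boldsymbol{\ell}}.$$ (ii) There exists $C>0$ such that for any $\mathbf{n}\in\mathbb{N}^d$ and any $\varepsilon>0$, $$\mathbb{P}\Big(\max_{\boldsymbol{\ell}\le\mathbf{n}}|S_{\boldsymbol{\ell}}|\,b_{\boldsymbol{\ell}}^{-1}\ge\varepsilon\Big)\le 4^{d}\,C\,\varepsilon^{-r}\sum_{\boldsymbol{\ell}\le\mathbf{n}}a_{\boldsymbol{\ell}}\,b_{\boldsymbol{\ell}}^{-r}.$$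
   Context: $d$ is a fixed positive integer and $\mathbb{N}$ is the set of nonnegative integers. $\mathbb{N}^d$ carries the coordinatewise partial order: $\mathbf{m}\le\mathbf{n}$ iff $m_i\le n_i$ for all $1\le i\le d$; $\mathbf{m}<\mathbf{n}$ means $\mathbf{m}\le\mathbf{n}$ and $\mathbf{m}\ne\mathbf{n}$; $\mathbf{0}=(0,\dots,0)$. $(X_{\mathbf{n}})_{\mathbf{n}\in\mathbb{N}^d}$ is a field of real random variables on a probability space $(\Omega,\mathcal{F},\mathbb{P})$, and its partial sums are $S_{\mathbf{0}}=0$ and $S_{\mathbf{n}}=\sum_{\mathbf{m}\le\mathbf{n}}X_{\mathbf{m}}$ for $\mathbf{n}>\mathbf{0}$. A $d$-sequence is a family of real numbers indexed by $\mathbb{N}^d$. A $d$-sequence $(b_{\mathbf{n}})$ is called positive, nondecreasing, of product type if $b_{\mathbf{n}}=\prod_{i=1}^d b^{(i)}_{n_i}$ for all $\mathbf{n}=(n_1,\dots,n_d)$, where for each $i=1,\dots,d$ the sequence $(b^{(i)}_{k})_{k\ge0}$ is a nondecreasing sequence of positive numbers.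
   Formalization: Statement (ii) is required for every positive, nondecreasing b of product type (C may depend on b), not for one fixed b; for fixed b, (ii) does not imply (i), e.g. r=1, a_0=1, other a_n=0, b_n=X_n=2^(n_1+...+n_d). *)

theory Defs
  imports "HOL-Probability.Probability"
begin

lemma finite_atMost_nat_vec [simp]: "finite {..n :: nat ^ 'd::finite}"
proof -
  have "inj_on vec_nth {..n}"
    by (simp add: inj_on_def vec_nth_inject)
  moreover have "vec_nth ` {..n} \<subseteq> (\<Pi>\<^sub>E i\<in>UNIV. {..n $ i})"
    by (auto simp: less_eq_vec_def)
  moreover have "finite (\<Pi>\<^sub>E i\<in>UNIV. {..n $ i})"
    by (intro finite_PiE) auto
  ultimately show ?thesis
    by (meson finite_imageD finite_subset)
qed

text \<open>
  The type \<open>nat ^ 'd\<close> carries the coordinatewise order, so \<open>{..n}\<close> is the set of all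
  multi-indices below \<open>n\<close>.  The value at \<open>0\<close> is \<open>0\<close> by convention and not \<open>X 0\<close>, although
  \<open>X 0\<close> is a summand of every other partial sum.
\<close>

definition partial_sum :: "(nat ^ 'd::finite \<Rightarrow> 'a \<Rightarrow> real) \<Rightarrow> nat ^ 'd \<Rightarrow> 'a \<Rightarrow> real" where
  "partial_sum X n \<omega> = (if n = 0 then 0 else (\<Sum>m\<in>{..n}. X m \<omega>))"

definition pos_nondecreasing_product_type :: "(nat ^ 'd::finite \<Rightarrow> real) \<Rightarrow> bool" where
  "pos_nondecreasing_product_type b \<longleftrightarrow>
     (\<exists>\<beta> :: 'd \<Rightarrow> nat \<Rightarrow> real.
        (\<forall>i. mono (\<beta> i)) \<and> (\<forall>i k. 0 < \<beta> i k) \<and> (\<forall>n. b n = (\<Prod>i\<in>UNIV. \<beta> i (n $ i))))"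

end

theory Submission
  imports Defs
begin

text \<open>
  For (i) implies (ii), group the multi-indices \<open>l\<close> by the vector \<open>k\<close> of integers with
  \<open>2^k\<^sub>i \<le> (\<beta>\<^sub>i l\<^sub>i)^r < 2^(k\<^sub>i+1)\<close>.  On one group \<open>b\<close> is at least \<open>\<Prod>\<^sub>i 2^(k\<^sub>i/r)\<close>, and the group
  lies below a single corner \<open>e k \<le> n\<close>, so (i) at this corner bounds its contribution by
  \<open>C \<epsilon>^(-r) (\<Prod>\<^sub>i 2^(-k\<^sub>i)) (\<Sum>l\<le>e k. a l)\<close>.  Summing over the groups and exchanging sums, the coefficient of
  \<open>a l\<close> is a product of \<open>d\<close> geometric series, each at most \<open>2 \<cdot> 2^(-k\<^sub>i) \<le> 4 (\<beta>\<^sub>i l\<^sub>i)^(-r)\<close>.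
  For the converse take \<open>b = 1\<close>.
\<close>

text \<open>Shifting the exponents by \<open>z\<close> maps \<open>A\<close> injectively into the
  naturals, so after factoring out \<open>2 powr (-z)\<close> what remains is part of the geometric
  series of ratio 1/2, whose sum is 2.\<close>

lemma sum_powr_neg_int_le:
  fixes A :: "int set"
  assumes "finite A" "A \<subseteq> {z..}"
  shows "(\<Sum>j\<in>A. 2 powr (- real_of_int j)) \<le> 2 * 2 powr (- real_of_int z)"
proof -
  define f where "f j = nat (j - z)" for j
  have ge: "z \<le> j" if "j \<in> A" for j
    using that assms(2) by auto
  have inj: "inj_on f A"
    using ge by (auto simp: inj_on_def f_def eq_nat_nat_iff)
  have "2 powr (- real_of_int j) = 2 powr (- real_of_int z) * (1/2) ^ f j" if "j \<in> A" for j
  proof -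
    have j: "real_of_int j = real_of_int z + real (f j)"
      using ge[OF that] by (simp add: f_def)
    show ?thesis
      by (simp add: j powr_diff powr_minus powr_realpow power_one_over field_simps powr_add)
  qed
  then have "(\<Sum>j\<in>A. 2 powr (- real_of_int j)) = 2 powr (- real_of_int z) * (\<Sum>i\<in>f ` A. (1/2) ^ i)"
    by (simp add: sum.reindex[OF inj] sum_distrib_left)
  also have "(\<Sum>i\<in>f ` A. (1/2::real) ^ i) \<le> (\<Sum>i. (1/2) ^ i)"
    using assms(1) by (intro sum_le_suminf) auto
  also have "(\<Sum>i. (1/2::real) ^ i) = 2"
    by (simp add: suminf_geometric)
  finally show ?thesis
    by simp
qed

text \<open>Enlarging \<open>P\<close> to the product of its coordinate projections only adds
  nonnegative terms. Over that box the sum of products factors into one-dimensional sums, and the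
  bound \<open>z i\<close> survives in each projection.\<close>

lemma sum_prod_powr_neg_int_le:
  fixes P :: "('d::finite \<Rightarrow> int) set"
  assumes "finite P" and "\<And>k i. k \<in> P \<Longrightarrow> z i \<le> k i"
  shows "(\<Sum>k\<in>P. \<Prod>i\<in>UNIV. 2 powr (- real_of_int (k i)))
           \<le> (\<Prod>i\<in>UNIV. 2 * 2 powr (- real_of_int (z i)))"
proof -
  define Q where "Q i = (\<lambda>k. k i) ` P" for i
  have fin: "finite (Q i)" for i
    using assms(1) by (simp add: Q_def)
  have "(\<Sum>k\<in>P. \<Prod>i\<in>UNIV. 2 powr (- real_of_int (k i)))
      \<le> (\<Sum>k\<in>Pi\<^sub>E UNIV Q. \<Prod>i\<in>UNIV. 2 powr (- real_of_int (k i)))"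
    using fin by (intro sum_mono2 finite_PiE) (auto simp: Q_def intro: prod_nonneg)
  also have "\<dots> = (\<Prod>i\<in>UNIV. \<Sum>j\<in>Q i. 2 powr (- real_of_int j))"
    using fin by (intro prod_sum_PiE[symmetric]) auto
  also have "\<dots> \<le> (\<Prod>i\<in>UNIV. 2 * 2 powr (- real_of_int (z i)))"
    using fin assms(2) by (intro prod_mono conjI sum_nonneg sum_powr_neg_int_le) (auto simp: Q_def)
  finally show ?thesis .
qed

lemma partial_sum_measurable [measurable]:
  assumes [measurable]: "\<And>n. X n \<in> borel_measurable M"
  shows "partial_sum X n \<in> borel_measurable M"
  unfolding partial_sum_def by measurable

text \<open>Trades the maximum for an existential, so that the events can be covered by finite
  unions.\<close>

lemma le_Max_atMost_vec_iff:
  fixes n :: "nat ^ 'd::finite" and f :: "nat ^ 'd \<Rightarrow> real"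
  shows "\<epsilon> \<le> Max (f ` {..n}) \<longleftrightarrow> (\<exists>l\<le>n. \<epsilon> \<le> f l)"
  by (subst Max_ge_iff) auto

text \<open>Here \<open>S\<close> and \<open>a\<close> are linked only through the unweighted
  inequality, so \<open>S\<close> may be any measurable field. The constant \<open>C\<close> is
  carried over unchanged.\<close>

lemma weighted_maximal_inequality:
  fixes S :: "nat ^ 'd::finite \<Rightarrow> 'a \<Rightarrow> real" and a :: "nat ^ 'd \<Rightarrow> real"
  assumes "prob_space M"
    and [measurable]: "\<And>n. S n \<in> borel_measurable M"
    and r: "r > 0"
    and a: "\<And>n. a n \<ge> 0"
    and C: "C \<ge> 0"
    and ineq: "\<And>n \<epsilon>. \<epsilon> > 0 \<Longrightarrow>
      \<P>(\<omega> in M. \<exists>l\<le>n. \<epsilon> \<le> \<bar>S l \<omega>\<bar>) \<le> C * \<epsilon> powr (-r) * (\<Sum>l\<in>{..n}. a l)"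
    and mono: "\<And>i. mono (\<beta> i)"
    and pos: "\<And>i k. 0 < \<beta> i k"
    and b: "\<And>n. b n = (\<Prod>i\<in>UNIV. \<beta> i (n $ i))"
    and \<epsilon>: "\<epsilon> > 0"
  shows "\<P>(\<omega> in M. \<exists>l\<le>n. \<epsilon> \<le> \<bar>S l \<omega>\<bar> * inverse (b l))
           \<le> 4 ^ CARD('d) * C * \<epsilon> powr (-r) * (\<Sum>l\<in>{..n}. a l * b l powr (-r))"
proof -
  interpret prob_space M by fact
  define \<kappa> where "\<kappa> i m = \<lfloor>log 2 (\<beta> i m powr r)\<rfloor>" for i m
  define K :: "nat ^ 'd \<Rightarrow> 'd \<Rightarrow> int" where "K l i = \<kappa> i (l $ i)" for l i
  \<comment> \<open>The condition is \<open>\<le>\<close> rather than equality: as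
    \<open>\<kappa> i\<close> is monotone, each set is an initial segment, and for \<open>k\<close>
    in \<open>P\<close> the indices below \<open>e k\<close> are exactly the
    \<open>l \<le> n\<close> with \<open>K l \<le> k\<close> coordinatewise.\<close>
  define e :: "('d \<Rightarrow> int) \<Rightarrow> nat ^ 'd" where "e k = (\<chi> i. Max {m. m \<le> n $ i \<and> \<kappa> i m \<le> k i})" for k
  \<comment> \<open>The division by \<open>r\<close> cancels when \<open>w k\<close> is raised to
    \<open>-r\<close>, which leaves integer powers of 2 to sum.\<close>
  define w :: "('d \<Rightarrow> int) \<Rightarrow> real" where "w k = (\<Prod>i\<in>UNIV. 2 powr (real_of_int (k i) / r))" for k
  define P where "P = K ` {..n}"
  have finP: "finite P"
    by (simp add: P_def)
  have w_pos: "0 < w k" for k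
    by (auto simp: w_def intro: prod_pos)
  have w_powr: "w k powr (-r) = (\<Prod>i\<in>UNIV. 2 powr (- real_of_int (k i)))" for k
    using r by (simp add: w_def prod_powr_distrib powr_powr)
  have \<kappa>_mono: "\<kappa> i m \<le> \<kappa> i m'" if "m \<le> m'" for i m m'
    unfolding \<kappa>_def using monoD[OF mono that, of i] pos[of i m] r
    by (intro floor_mono log_mono powr_mono2) (auto intro: less_imp_le)
  \<comment> \<open>Membership in \<open>P\<close> provides an index in the group, so the maximum
    defining each coordinate of the corner is over a nonempty set.\<close>
  have e_mem: "e k $ i \<le> n $ i \<and> \<kappa> i (e k $ i) \<le> k i" if k: "k \<in> P" for k i
  proof -
    let ?A = "{m. m \<le> n $ i \<and> \<kappa> i m \<le> k i}"
    obtain l where "l \<le> n" "k = K l"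
      using k by (auto simp: P_def)
    then have "l $ i \<in> ?A"
      by (simp add: K_def less_eq_vec_def)
    then have "Max ?A \<in> ?A"
      by (intro Max_in) auto
    then show ?thesis by (simp add: e_def)
  qed
  have le_e: "l \<le> e (K l)" if "l \<le> n" for l
    using that by (auto simp: less_eq_vec_def e_def K_def intro!: Max_ge)
  \<comment> \<open>The bound on \<open>K l\<close> starts the geometric series in
    \<open>coeff\<close>; the bound \<open>l \<le> n\<close> later permits the exchange of
    sums.\<close>
  have below_e: "l \<le> n \<and> (\<forall>i. K l i \<le> k i)" if "k \<in> P" "l \<le> e k" for k l
    using e_mem[OF that(1)] that(2) \<kappa>_mono unfolding less_eq_vec_def K_def
    by (meson order_trans)
  have w_le: "w (K l) \<le> b l" for l
    unfolding w_def b
  proof (intro prod_mono conjI)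
    fix i
    have "real_of_int (K l i) \<le> r * log 2 (\<beta> i (l $ i))"
      using pos[of i "l $ i"] by (simp add: K_def \<kappa>_def log_powr)
    then have "2 powr (real_of_int (K l i) / r) \<le> 2 powr (log 2 (\<beta> i (l $ i)))"
      using r by (intro powr_mono) (auto simp: field_simps)
    then show "2 powr (real_of_int (K l i) / r) \<le> \<beta> i (l $ i)"
      using pos[of i "l $ i"] by simp
  qed simp
  have coeff: "(\<Sum>k | k \<in> P \<and> l \<le> e k. w k powr (-r)) \<le> 4 ^ CARD('d) * b l powr (-r)" for l
  proof -
    have "(\<Sum>k | k \<in> P \<and> l \<le> e k. w k powr (-r)) \<le> (\<Prod>i\<in>UNIV. 2 * 2 powr (- real_of_int (K l i)))"
      unfolding w_powr using finP below_e by (intro sum_prod_powr_neg_int_le) auto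
    also have "\<dots> \<le> (\<Prod>i\<in>UNIV. 4 * \<beta> i (l $ i) powr (-r))"
    proof (intro prod_mono conjI)
      fix i
      \<comment> \<open>Rounding down loses less than 1 in the exponent, hence one factor 2; the
        other factor 2 of the 4 is the sum of the geometric series.\<close>
      have "log 2 (\<beta> i (l $ i) powr r) \<le> real_of_int (K l i) + 1"
        unfolding K_def \<kappa>_def by linarith
      then have "r * log 2 (\<beta> i (l $ i)) \<le> real_of_int (K l i) + 1"
        using pos[of i "l $ i"] by (simp add: log_powr)
      then have "2 powr (- real_of_int (K l i)) \<le> 2 powr (1 + log 2 (\<beta> i (l $ i)) * (-r))"
        by (intro powr_mono) (auto simp: algebra_simps)
      also have "\<dots> = 2 * (2 powr log 2 (\<beta> i (l $ i))) powr (-r)"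
        by (simp only: powr_add powr_powr) simp
      also have "2 powr log 2 (\<beta> i (l $ i)) = \<beta> i (l $ i)"
        using pos[of i "l $ i"] by simp
      finally show "2 * 2 powr (- real_of_int (K l i)) \<le> 4 * \<beta> i (l $ i) powr (-r)"
        by simp
    qed simp
    also have "\<dots> = 4 ^ CARD('d) * b l powr (-r)"
      using pos by (simp add: b prod.distrib prod_powr_distrib less_imp_le)
    finally show ?thesis .
  qed

  have "\<P>(\<omega> in M. \<exists>l\<le>n. \<epsilon> \<le> \<bar>S l \<omega>\<bar> * inverse (b l))
      \<le> measure M (\<Union>k\<in>P. {\<omega> \<in> space M. \<exists>l\<in>{..e k}. \<epsilon> * w k \<le> \<bar>S l \<omega>\<bar>})"
  proof (rule finite_measure_mono)
    show "{\<omega> \<in> space M. \<exists>l\<le>n. \<epsilon> \<le> \<bar>S l \<omega>\<bar> * inverse (b l)}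
        \<subseteq> (\<Union>k\<in>P. {\<omega> \<in> space M. \<exists>l\<in>{..e k}. \<epsilon> * w k \<le> \<bar>S l \<omega>\<bar>})"
    proof clarsimp
      fix \<omega> l
      assume l: "l \<le> n" and le: "\<epsilon> \<le> \<bar>S l \<omega>\<bar> * inverse (b l)"
      have "0 < b l"
        using w_pos w_le by (rule less_le_trans)
      then have "\<epsilon> * b l \<le> \<bar>S l \<omega>\<bar>"
        using le by (simp add: field_simps)
      moreover have "\<epsilon> * w (K l) \<le> \<epsilon> * b l"
        using w_le \<epsilon> by (intro mult_left_mono) auto
      \<comment> \<open>The group of \<open>l\<close> itself, \<open>k = K l\<close>, is the
        witness: \<open>l\<close> lies below its corner.\<close>
      ultimately show "\<exists>k\<in>P. \<exists>l\<in>{..e k}. \<epsilon> * w k \<le> \<bar>S l \<omega>\<bar>"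
        using l le_e[OF l] by (intro bexI[of _ "K l"] bexI[of _ l]) (auto simp: P_def)
    qed
    show "(\<Union>k\<in>P. {\<omega> \<in> space M. \<exists>l\<in>{..e k}. \<epsilon> * w k \<le> \<bar>S l \<omega>\<bar>}) \<in> sets M"
      using finP by (intro sets.finite_UN) auto
  qed
  also have "\<dots> \<le> (\<Sum>k\<in>P. \<P>(\<omega> in M. \<exists>l\<in>{..e k}. \<epsilon> * w k \<le> \<bar>S l \<omega>\<bar>))"
    using finP by (intro finite_measure_subadditive_finite) auto
  \<comment> \<open>The hypothesis is applied at the corner \<open>e k\<close> with the threshold
    raised to \<open>\<epsilon> * w k\<close>.\<close>
  also have "\<dots> \<le> (\<Sum>k\<in>P. C * (\<epsilon> * w k) powr (-r) * (\<Sum>l\<in>{..e k}. a l))"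
    using ineq \<epsilon> w_pos by (intro sum_mono) (simp add: Bex_def)
  also have "\<dots> = C * \<epsilon> powr (-r) * (\<Sum>k\<in>P. \<Sum>l\<in>{..e k}. a l * w k powr (-r))"
    using \<epsilon> w_pos
    by (simp add: powr_mult less_imp_le sum_distrib_left sum_distrib_right mult_ac)
  \<comment> \<open>By \<open>below_e\<close> the restriction to \<open>{..n}\<close> changes
    nothing, but it gives the inner sum a range independent of \<open>k\<close>, up to the relation
    \<open>l \<le> e k\<close>.\<close>
  also have "(\<Sum>k\<in>P. \<Sum>l\<in>{..e k}. a l * w k powr (-r))
      = (\<Sum>k\<in>P. \<Sum>l | l \<in> {..n} \<and> l \<le> e k. a l * w k powr (-r))"
    using below_e by (intro sum.cong) auto
  also have "\<dots> = (\<Sum>l\<in>{..n}. \<Sum>k | k \<in> P \<and> l \<le> e k. a l * w k powr (-r))"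
    using finP by (intro sum.swap_restrict) auto
  also have "C * \<epsilon> powr (-r) * \<dots>
      \<le> C * \<epsilon> powr (-r) * (\<Sum>l\<in>{..n}. a l * (4 ^ CARD('d) * b l powr (-r)))"
    using C a coeff
    by (intro mult_left_mono sum_mono) (auto simp flip: sum_distrib_left intro: mult_left_mono)
  also have "\<dots> = 4 ^ CARD('d) * C * \<epsilon> powr (-r) * (\<Sum>l\<in>{..n}. a l * b l powr (-r))"
    by (simp add: sum_distrib_left mult_ac)
  finally show ?thesis .
qed

text \<open>The second statement ranges over all \<open>b\<close> of product type, and its
  \<open>C\<close> may depend on \<open>b\<close>. The forward direction nevertheless yields one
  \<open>C\<close> for every \<open>b\<close>.\<close>

theorem proposition2:
  fixes M :: "'a measure"
    and X :: "nat ^ 'd::finite \<Rightarrow> 'a \<Rightarrow> real"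
    and a :: "nat ^ 'd \<Rightarrow> real"
    and r :: real
  assumes "prob_space M"
    and "\<And>n. X n \<in> borel_measurable M"
    and "r > 0"
    and "\<And>n. a n \<ge> 0"
  shows "(\<exists>C>0. \<forall>n. \<forall>\<epsilon>>0.
            \<P>(\<omega> in M. Max ((\<lambda>l. \<bar>partial_sum X l \<omega>\<bar>) ` {..n}) \<ge> \<epsilon>)
              \<le> C * \<epsilon> powr (-r) * (\<Sum>l\<in>{..n}. a l))
     \<longleftrightarrow>
     (\<forall>b. pos_nondecreasing_product_type b \<longrightarrow>
        (\<exists>C>0. \<forall>n. \<forall>\<epsilon>>0.
            \<P>(\<omega> in M. Max ((\<lambda>l. \<bar>partial_sum X l \<omega>\<bar> * inverse (b l)) ` {..n}) \<ge> \<epsilon>)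
              \<le> 4 ^ CARD('d) * C * \<epsilon> powr (-r) * (\<Sum>l\<in>{..n}. a l * b l powr (-r))))"
proof (intro iffI allI impI)
  assume "\<exists>C>0. \<forall>n. \<forall>\<epsilon>>0.
    \<P>(\<omega> in M. Max ((\<lambda>l. \<bar>partial_sum X l \<omega>\<bar>) ` {..n}) \<ge> \<epsilon>) \<le> C * \<epsilon> powr (-r) * (\<Sum>l\<in>{..n}. a l)"
  then obtain C where C: "C > 0"
    and ineq: "\<And>n \<epsilon>. \<epsilon> > 0 \<Longrightarrow>
      \<P>(\<omega> in M. \<exists>l\<le>n. \<epsilon> \<le> \<bar>partial_sum X l \<omega>\<bar>) \<le> C * \<epsilon> powr (-r) * (\<Sum>l\<in>{..n}. a l)"
    unfolding le_Max_atMost_vec_iff by blast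
  fix b :: "nat ^ 'd \<Rightarrow> real"
  assume "pos_nondecreasing_product_type b"
  then obtain \<beta> where \<beta>: "\<And>i. mono (\<beta> i)" "\<And>i k. 0 < \<beta> i k" "\<And>n. b n = (\<Prod>i\<in>UNIV. \<beta> i (n $ i))"
    unfolding pos_nondecreasing_product_type_def by blast
  show "\<exists>C>0. \<forall>n. \<forall>\<epsilon>>0.
    \<P>(\<omega> in M. Max ((\<lambda>l. \<bar>partial_sum X l \<omega>\<bar> * inverse (b l)) ` {..n}) \<ge> \<epsilon>)
      \<le> 4 ^ CARD('d) * C * \<epsilon> powr (-r) * (\<Sum>l\<in>{..n}. a l * b l powr (-r))"
    unfolding le_Max_atMost_vec_iff
    using weighted_maximal_inequality[OF assms(1) partial_sum_measurable assms(3,4) _ ineq \<beta>] assms(2) C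
    by (intro exI[of _ C]) auto
next
  assume "\<forall>b. pos_nondecreasing_product_type b \<longrightarrow>
    (\<exists>C>0. \<forall>n. \<forall>\<epsilon>>0.
      \<P>(\<omega> in M. Max ((\<lambda>l. \<bar>partial_sum X l \<omega>\<bar> * inverse (b l)) ` {..n}) \<ge> \<epsilon>)
        \<le> 4 ^ CARD('d) * C * \<epsilon> powr (-r) * (\<Sum>l\<in>{..n}. a l * b l powr (-r)))"
  moreover have "pos_nondecreasing_product_type (\<lambda>_ :: nat ^ 'd. 1)"
    unfolding pos_nondecreasing_product_type_def
    by (intro exI[of _ "\<lambda>_ _. 1"]) (simp add: mono_def)
  ultimately obtain C where "C > 0" and "\<And>n \<epsilon>. \<epsilon> > 0 \<Longrightarrow>
      \<P>(\<omega> in M. Max ((\<lambda>l. \<bar>partial_sum X l \<omega>\<bar>) ` {..n}) \<ge> \<epsilon>)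
        \<le> 4 ^ CARD('d) * C * \<epsilon> powr (-r) * (\<Sum>l\<in>{..n}. a l)"
    by (auto dest!: spec[of _ "\<lambda>_. 1"])
  then show "\<exists>C>0. \<forall>n. \<forall>\<epsilon>>0.
    \<P>(\<omega> in M. Max ((\<lambda>l. \<bar>partial_sum X l \<omega>\<bar>) ` {..n}) \<ge> \<epsilon>) \<le> C * \<epsilon> powr (-r) * (\<Sum>l\<in>{..n}. a l)"
    \<comment> \<open>The factor \<open>4 ^ CARD('d)\<close> is absorbed into the constant.\<close>
    by (intro exI[of _ "4 ^ CARD('d) * C"]) auto
qed

end
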